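(* For the class $\mathcal{S}_R^*$ of starlike functions associated with the rational function $\psi$, the following hold: (i) $R_{\mathcal{S}_{R}^{*}}(\mathcal{G}_1)= \dfrac{3-2\sqrt{2}}{3+\sqrt{26-12\sqrt{2}}}\approx 0.0285$; (ii) $R_{\mathcal{S}_{R}^{*}}(\mathcal{G}_2)\geq \dfrac{20-14\sqrt{2}}{(2-\sqrt{2})\left(5+\sqrt{105-56\sqrt{2}}\right)}\approx 0.0340$; (iii) $R_{\mathcal{S}_{R}^{*}}(\mathcal{G}_3)= \dfrac{3-2\sqrt{2}}{2+\sqrt{21-12\sqrt{2}}}\approx 0.0428$.
   Context: $\mathbb{D}$ is the open unit disc in $\mathbb{C}$. $\mathcal{A}$ is the class of analytic functions $f$ on $\mathbb{D}$ with $f(0)=0$, $f'(0)=1$. $\mathcal{P}$ is the class of analytic functions $p$ on $\mathbb{D}$ with $p(0)=1$ and $\operatorname{Re}p(z)>0$ for all $z\in\mathbb{D}$; $\mathcal{P}(1/2)=\{p\in\mathcal{P}:\operatorname{Re}p(z)>1/2 \text{ for all } z\in\mathbb{D}\}$. Quotients below are understood with removable singularities filled in (in particular at $0$). Define $\mathcal{G}_1=\{f\in\mathcal{A}: f/g\in\mathcal{P}\text{ and } g/(zp)\in\mathcal{P}\text{ for some } g\in\mathcal{A},\ p\in\mathcal{P}\}$, $\mathcal{G}_2=\{f\in\mathcal{A}: f/g\in\mathcal{P}\text{ and } g/(zp)\in\mathcal{P}(1/2)\text{ for some } g\in\mathcal{A},\ p\in\mathcal{P}\}$, $\mathcal{G}_3=\{f\in\mathcal{A}: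 f/(zp)\in\mathcal{P}\text{ for some } p\in\mathcal{P}\}$. For subclasses $\mathcal{F},\mathcal{G}$ of $\mathcal{A}$, the $\mathcal{G}$-radius $R_{\mathcal{G}}(\mathcal{F})$ of $\mathcal{F}$ is the largest number $R\in(0,1)$ such that, for every $f\in\mathcal{F}$ and every $0<r<R$, the function $z\mapsto r^{-1}f(rz)$ belongs to $\mathcal{G}$. For analytic $f,g$ on $\mathbb{D}$, $f\prec g$ ($f$ is subordinate to $g$) means $f=g\circ w$ for some analytic $w:\mathbb{D}\to\mathbb{D}$ with $w(0)=0$. For an analytic univalent $\varphi$ on $\mathbb{D}$ with $\varphi(0)=1$, $\mathcal{S}^*(\varphi)=\{f\in\mathcal{A}: zf'(z)/f(z)\prec\varphi(z)\}$. $\mathcal{S}_R^*=\mathcal{S}^*(\psi)$ with $\psi(z)=1+\dfrac{zk+z^2}{k^2-kz}$, $k=\sqrt{2}+1$. *)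

theory Defs
  imports "HOL-Complex_Analysis.Complex_Analysis"
begin

text \<open>
  Functions on the unit disc are represented by total functions on the complex plane; only their
  values on the disc matter in all definitions below. Quotients with removable singularities
  filled in are rendered by \<^const>\<open>remove_sings\<close>, which at every point takes the limit of the
  quotient if that limit exists, and 0 otherwise. The fallback value 0 admits no functions with
  poles: the results are always required to be holomorphic on the disc, and 0 at an isolated point
  would violate continuity.
\<close>

abbreviation unit_disc :: "complex set"
  where "unit_disc \<equiv> ball 0 1"

definition normalized :: "(complex \<Rightarrow> complex) set"
  where "normalized = {f. f holomorphic_on unit_disc \<and> f 0 = 0 \<and> deriv f 0 = 1}"

definition caratheodory :: "(complex \<Rightarrow> complex) set"
  where "caratheodory =
    {p. p holomorphic_on unit_disc \<and> p 0 = 1 \<and> (\<forall>z\<in>unit_disc. Re (p z) > 0)}"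

definition caratheodory_half :: "(complex \<Rightarrow> complex) set"
  where "caratheodory_half = {p \<in> caratheodory. \<forall>z\<in>unit_disc. Re (p z) > 1 / 2}"

definition G1 :: "(complex \<Rightarrow> complex) set"
  where "G1 = {f \<in> normalized. \<exists>g\<in>normalized. \<exists>p\<in>caratheodory.
    remove_sings (\<lambda>z. f z / g z) \<in> caratheodory \<and>
    remove_sings (\<lambda>z. g z / (z * p z)) \<in> caratheodory}"

definition G2 :: "(complex \<Rightarrow> complex) set"
  where "G2 = {f \<in> normalized. \<exists>g\<in>normalized. \<exists>p\<in>caratheodory.
    remove_sings (\<lambda>z. f z / g z) \<in> caratheodory \<and>
    remove_sings (\<lambda>z. g z / (z * p z)) \<in> caratheodory_half}"

definition G3 :: "(complex \<Rightarrow> complex) set"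
  where "G3 = {f \<in> normalized. \<exists>p\<in>caratheodory.
    remove_sings (\<lambda>z. f z / (z * p z)) \<in> caratheodory}"

definition subordinate :: "(complex \<Rightarrow> complex) \<Rightarrow> (complex \<Rightarrow> complex) \<Rightarrow> bool"
  where "subordinate f g \<longleftrightarrow> f holomorphic_on unit_disc \<and> g holomorphic_on unit_disc \<and>
    (\<exists>w. w holomorphic_on unit_disc \<and> w ` unit_disc \<subseteq> unit_disc \<and> w 0 = 0 \<and>
         (\<forall>z\<in>unit_disc. f z = g (w z)))"

definition starlike_class :: "(complex \<Rightarrow> complex) \<Rightarrow> (complex \<Rightarrow> complex) set"
  where "starlike_class \<phi> =
    {f \<in> normalized. subordinate (remove_sings (\<lambda>z. z * deriv f z / f z)) \<phi>}"

definition psi :: "complex \<Rightarrow> complex"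
  where "psi z = (let k = complex_of_real (sqrt 2 + 1) in 1 + (z * k + z\<^sup>2) / (k\<^sup>2 - k * z))"

definition S_R :: "(complex \<Rightarrow> complex) set"
  where "S_R = starlike_class psi"

definition admissible_radii ::
    "(complex \<Rightarrow> complex) set \<Rightarrow> (complex \<Rightarrow> complex) set \<Rightarrow> real set"
  where "admissible_radii \<G> \<F> = {R. 0 < R \<and> R < 1 \<and>
    (\<forall>f\<in>\<F>. \<forall>r. 0 < r \<and> r < R \<longrightarrow> (\<lambda>z. f (of_real r * z) / of_real r) \<in> \<G>)}"

text \<open>
  The \<open>\<G>\<close>-radius of \<open>\<F>\<close> is a largest element, so its existence is part of the claim that it has
  a certain value; hence a relation instead of a total function.
\<close>

definition is_class_radius ::
    "(complex \<Rightarrow> complex) set \<Rightarrow> (complex \<Rightarrow> complex) set \<Rightarrow> real \<Rightarrow> bool"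
  where "is_class_radius \<G> \<F> R \<longleftrightarrow>
    R \<in> admissible_radii \<G> \<F> \<and> (\<forall>R'\<in>admissible_radii \<G> \<F>. R' \<le> R)"

end

theory Submission
  imports Defs
begin

text \<open>
  A member of any of the three classes is \<open>f z = z * P z\<close> with \<open>P\<close> a product of Caratheodory
  functions, so that \<open>z f'(z) / f(z) - 1\<close> is the sum of the terms \<open>z p'(z) / p(z)\<close> over the factors
  \<open>p\<close> of \<open>P\<close>. Write \<open>r = |z|\<close>. By the Schwarz lemma each term has modulus at most
  \<open>2 r / (1 - r\<^sup>2)\<close>, and at most \<open>r / (1 - r)\<close> if the factor has real part above \<open>1/2\<close>
  (lemmas \<open>norm_log_deriv_caratheodory_le\<close> and \<open>norm_log_deriv_caratheodory_half_le\<close>). The sums of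
  these bounds are \<open>6 r / (1 - r\<^sup>2)\<close>, \<open>(5 r + r\<^sup>2) / (1 - r\<^sup>2)\<close> and \<open>4 r / (1 - r\<^sup>2)\<close> for
  \<open>G1\<close>, \<open>G2\<close> and \<open>G3\<close>.

  On the other side, with \<open>k = sqrt 2 + 1\<close> and \<open>c = 1 / k\<^sup>2 = 3 - 2 sqrt 2\<close>, the image of the
  disc under \<open>psi\<close> contains the disc of radius \<open>c\<close> about \<open>1\<close>, and \<open>psi\<close> has a holomorphic right
  inverse there (\<open>psi_right_inverse\<close>); hence a function with values in that disc and value \<open>1\<close> at
  \<open>0\<close> is subordinate to \<open>psi\<close>. So the dilations of \<open>f\<close> are in \<open>S_R\<close> as long as the bound stays
  below \<open>c\<close>, and the claimed numbers are the values of \<open>r\<close> at which the bound equals \<open>c\<close>,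
  which is a quadratic equation.

  The disc cannot be enlarged at its leftmost point, as \<open>1 - c = psi (-1)\<close> has no other preimage
  (\<open>psi_value_at_minus_1_not_attained\<close>). The functions \<open>z * ((1 + z) / (1 - z)) ^ n\<close>, with \<open>n = 3\<close> for
  \<open>G1\<close> and \<open>n = 2\<close> for \<open>G3\<close>, satisfy \<open>z f'(z) / f(z) = 1 + 2 n z / (1 - z\<^sup>2)\<close>, and therefore
  reach \<open>1 - c\<close> exactly at minus the claimed radius; this gives sharpness. For \<open>G2\<close> the radius is
  a supremum of admissible numbers, which is itself admissible as soon as it is below \<open>1\<close>; that
  holds because \<open>G3\<close> is contained in \<open>G2\<close>.
\<close>

section \<open>Quotients with removable singularities\<close>

lemma eventually_ne_0_normalized:
  assumes "g \<in> normalized"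
  shows "\<forall>\<^sub>F z in at 0. g z \<noteq> 0"
proof -
  have "g field_differentiable at 0"
    using assms holomorphic_on_imp_differentiable_at[of g unit_disc 0] by (auto simp: normalized_def)
  hence "(g has_field_derivative 1) (at 0)"
    using assms field_differentiable_derivI[of g 0] by (auto simp: normalized_def)
  hence "((\<lambda>z. g z / z) \<longlongrightarrow> 1) (at 0)"
    using assms by (simp add: has_field_derivative_iff normalized_def)
  hence "\<forall>\<^sub>F z in at 0. g z / z \<noteq> 0"
    by (rule tendsto_imp_eventually_ne) auto
  thus ?thesis by eventually_elim auto
qed

text \<open>
  The denominator may vanish away from \<open>0\<close>. Near \<open>0\<close> it does not, except at \<open>0\<close> itself, so the
  identity holds on a punctured neighbourhood and spreads by analytic continuation.
\<close>

lemma eq_mult_remove_sings_quotient: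
  assumes f: "f holomorphic_on unit_disc" and g: "g \<in> normalized"
    and q: "remove_sings (\<lambda>z. f z / g z) holomorphic_on unit_disc" and z: "z \<in> unit_disc"
  shows "f z = g z * remove_sings (\<lambda>z. f z / g z) z"
proof -
  have hg: "g holomorphic_on unit_disc" using g by (simp add: normalized_def)
  have "\<forall>\<^sub>F z in at 0. g z \<noteq> 0 \<and> z \<in> unit_disc"
    using eventually_ne_0_normalized[OF g] eventually_at_in_open'[of unit_disc 0]
    by (auto intro: eventually_conj)
  then obtain e where e: "e > 0" "\<And>z. z \<noteq> 0 \<Longrightarrow> dist z 0 < e \<Longrightarrow> g z \<noteq> 0 \<and> z \<in> unit_disc"
    unfolding eventually_at by auto
  define s where "s = ball 0 e - {0 :: complex}"
  show ?thesis
  proof (rule analytic_continuation_open[of s unit_disc f])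
    show "open s" by (auto simp: s_def)
    have "of_real (e / 2) \<in> s" using e(1) by (auto simp: s_def)
    thus "s \<noteq> {}" by blast
    show "s \<subseteq> unit_disc" using e(2) unfolding s_def by (metis DiffE dist_commute insertCI mem_ball subsetI)
    show "(\<lambda>z. g z * remove_sings (\<lambda>z. f z / g z) z) holomorphic_on unit_disc"
      using hg q by (intro holomorphic_intros)
    fix w assume "w \<in> s"
    hence w: "g w \<noteq> 0" "w \<in> unit_disc" using e(2)[of w] by (auto simp: s_def)
    have "f analytic_on {w}" "g analytic_on {w}"
      using f hg w(2) by (auto intro: analytic_on_subset simp: analytic_on_open[symmetric])
    hence "(\<lambda>z. f z / g z) analytic_on {w}" using w(1) by (intro analytic_intros) auto
    thus "f w = g w * remove_sings (\<lambda>z. f z / g z) w" using w(1) by simp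
  qed (use f z in auto)
qed

text \<open>
  Converse direction: a known holomorphic quotient is recovered, whatever value the raw quotient has
  at \<open>0\<close>.
\<close>

lemma remove_sings_quotientI:
  assumes h: "h holomorphic_on unit_disc"
    and eq: "\<And>z. z \<in> unit_disc \<Longrightarrow> z \<noteq> 0 \<Longrightarrow> g z \<noteq> 0 \<and> f z = g z * h z"
    and z: "z \<in> unit_disc"
  shows "remove_sings (\<lambda>z. f z / g z) z = h z"
proof (rule remove_sings_eqI)
  have "h \<midarrow>z\<rightarrow> h z"
    using h z by (metis at_within_open centre_in_ball continuous_on holomorphic_on_imp_continuous_on open_ball)
  moreover have "\<forall>\<^sub>F w in at z. h w = f w / g w"
  proof -
    have "\<forall>\<^sub>F w in at z. w \<in> unit_disc" using z by (intro eventually_at_in_open') auto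
    moreover have "\<forall>\<^sub>F w in at z. w \<noteq> 0" by (metis eventually_neq_at_within)
    ultimately show ?thesis by eventually_elim (use eq in auto)
  qed
  ultimately show "(\<lambda>z. f z / g z) \<midarrow>z\<rightarrow> h z" by (rule Lim_transform_eventually)
qed

section \<open>Functions with positive real part\<close>

text \<open>
  This is the Schwarz-Pick inequality for maps of the disc into the right half-plane. Move \<open>a\<close> to
  \<open>0\<close> by a disc automorphism and \<open>p a\<close> to \<open>0\<close> by the Cayley transform of the half-plane; then the
  Schwarz lemma bounds the derivative of the composition at \<open>0\<close>.
\<close>

lemma norm_deriv_positive_real_part_le:
  assumes p: "p holomorphic_on unit_disc" and pos: "\<And>z. z \<in> unit_disc \<Longrightarrow> Re (p z) > 0"
    and a: "a \<in> unit_disc"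
  shows "norm (deriv p a) \<le> 2 * Re (p a) / (1 - (norm a)\<^sup>2)"
proof -
  define \<phi> where "\<phi> = Moebius_function 0 (- a)"
  have na: "norm (- a) < 1" using a by simp
  have \<phi>_in: "\<phi> z \<in> unit_disc" if "norm z < 1" for z
    using Moebius_function_norm_lt_1[OF na that] by (simp add: \<phi>_def)
  have h\<phi>: "\<phi> holomorphic_on unit_disc"
    unfolding \<phi>_def by (rule Moebius_function_holomorphic[OF na])
  have \<phi>0: "\<phi> 0 = a" by (simp add: \<phi>_def Moebius_function_of_zero)
  have \<phi>_eq: "\<phi> = (\<lambda>z. (z + a) / (1 + cnj a * z))"
    by (auto simp: \<phi>_def Moebius_function_simple fun_eq_iff)
  have d\<phi>: "(\<phi> has_field_derivative 1 - (norm a)\<^sup>2) (at 0)"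
    unfolding \<phi>_eq by (auto intro!: derivative_eq_intros simp: complex_norm_square[symmetric] mult.commute)
  have dp: "(p has_field_derivative deriv p a) (at a)"
    using p a by (auto intro: holomorphic_derivI)
  (* the Cayley transform that sends p a to 0 *)
  define w where "w = (\<lambda>z. (p (\<phi> z) - p a) / (p (\<phi> z) + cnj (p a)))"
  have pa: "Re (p a) > 0" using pos a by blast
  have ne: "p (\<phi> z) + cnj (p a) \<noteq> 0" if "norm z < 1" for z
  proof
    assume "p (\<phi> z) + cnj (p a) = 0"
    from arg_cong[OF this, of Re] show False using pos[OF \<phi>_in[OF that]] pa by simp
  qed
  have hp: "(\<lambda>z. p (\<phi> z)) holomorphic_on unit_disc"
    using holomorphic_on_compose_gen[OF h\<phi> p] \<phi>_in by (auto simp: o_def image_subset_iff)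
  have hw: "w holomorphic_on unit_disc"
    unfolding w_def using hp ne by (intro holomorphic_intros) auto
  have "norm (w z) < 1" if "norm z < 1" for z
  proof -
    have "(norm (p (\<phi> z) - p a))\<^sup>2 < (norm (p (\<phi> z) + cnj (p a)))\<^sup>2"
      using pos[OF \<phi>_in[OF that]] pa
      unfolding cmod_power2 by (simp add: power2_eq_square algebra_simps add_pos_pos)
    hence "norm (p (\<phi> z) - p a) < norm (p (\<phi> z) + cnj (p a))"
      by (rule power_less_imp_less_base) auto
    thus ?thesis using ne[OF that] by (simp add: w_def norm_divide)
  qed
  moreover have "w 0 = 0" by (simp add: w_def \<phi>0)
  ultimately have le: "norm (deriv w 0) \<le> 1"
    using Schwarz_Lemma(2)[OF hw, of 0] by auto
  (* the denominator of w at 0 *)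
  have sum: "p a + cnj (p a) = of_real (2 * Re (p a))" by (simp add: complex_add_cnj)
  have d: "((\<lambda>z. p (\<phi> z)) has_field_derivative deriv p a * (1 - (norm a)\<^sup>2)) (at 0)"
    using DERIV_chain2[of p "deriv p a" \<phi> 0] dp d\<phi> by (simp add: \<phi>0)
  have "(w has_field_derivative deriv p a * (1 - (norm a)\<^sup>2) / of_real (2 * Re (p a))) (at 0)"
    unfolding w_def
    by (rule derivative_eq_intros d refl)+ (use pa sum in \<open>auto simp: \<phi>0 sum field_simps\<close>)
  hence "deriv w 0 = deriv p a * (1 - (norm a)\<^sup>2) / of_real (2 * Re (p a))"
    by (rule DERIV_imp_deriv)
  also have "\<dots> = deriv p a * of_real ((1 - (norm a)\<^sup>2) / (2 * Re (p a)))"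
    by simp
  finally have 1: "norm (deriv w 0) = norm (deriv p a) * \<bar>(1 - (norm a)\<^sup>2) / (2 * Re (p a))\<bar>"
    by (metis norm_mult norm_of_real)
  have "(norm a)\<^sup>2 < 1" using a by (simp add: abs_square_less_1)
  thus ?thesis using le pa unfolding 1 by (simp add: field_simps)
qed

lemma caratheodory_ne_0: "p \<in> caratheodory \<Longrightarrow> z \<in> unit_disc \<Longrightarrow> p z \<noteq> 0"
  by (force simp: caratheodory_def)

lemma norm_log_deriv_caratheodory_le:
  assumes p: "p \<in> caratheodory" and z: "z \<in> unit_disc"
  shows "norm (deriv p z / p z) \<le> 2 / (1 - (norm z)\<^sup>2)"
proof -
  have 1: "(norm z)\<^sup>2 < 1" using z by (simp add: abs_square_less_1)
  have "norm (deriv p z) \<le> 2 * Re (p z) / (1 - (norm z)\<^sup>2)"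
    using p z by (intro norm_deriv_positive_real_part_le) (auto simp: caratheodory_def)
  also have "\<dots> \<le> 2 * norm (p z) / (1 - (norm z)\<^sup>2)"
    using 1 complex_Re_le_cmod[of "p z"] by (intro divide_right_mono) auto
  finally show ?thesis
    using caratheodory_ne_0[OF p z] by (simp add: norm_divide field_simps)
qed

text \<open>
  Here \<open>2 p - 1\<close> has positive real part, so \<open>|p'| \<le> (2 Re p - 1) / (1 - r\<^sup>2)\<close> with \<open>r = |z|\<close>.
  Moreover \<open>1 - 1 / p\<close> maps the disc into itself and fixes \<open>0\<close>, so \<open>1 / |p| \<ge> 1 - r\<close> by the
  Schwarz lemma, and \<open>(2 Re p - 1) / |p| \<le> 2 - 1 / |p| \<le> 1 + r\<close>.
\<close>

lemma norm_log_deriv_caratheodory_half_le: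
  assumes p: "p \<in> caratheodory_half" and z: "z \<in> unit_disc"
  shows "norm (deriv p z / p z) \<le> 1 / (1 - norm z)"
proof -
  have hp: "p holomorphic_on unit_disc" and p0: "p 0 = 1"
    and half: "\<And>w. w \<in> unit_disc \<Longrightarrow> 1 < 2 * Re (p w)"
    using p by (auto simp: caratheodory_half_def caratheodory_def mult.commute)
  have ne: "p w \<noteq> 0" if "w \<in> unit_disc" for w
    using half[OF that] by auto
  define v where "v = (\<lambda>w. 1 - 1 / p w)"
  have hv: "v holomorphic_on unit_disc"
    unfolding v_def using hp ne by (intro holomorphic_intros) auto
  have v_lt: "norm (v w) < 1" if "norm w < 1" for w
  proof -
    have w: "w \<in> unit_disc" using that by simp
    (* the half-plane Re > 1/2 consists of the points nearer to 1 than to 0 *)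
    have "(norm (p w - 1))\<^sup>2 < (norm (p w))\<^sup>2"
      using half[OF w] unfolding cmod_power2 by (simp add: power2_eq_square algebra_simps)
    hence "norm (p w - 1) < norm (p w)" by (rule power_less_imp_less_base) auto
    moreover have "v w = (p w - 1) / p w" using ne[OF w] by (simp add: v_def field_simps)
    ultimately show ?thesis using ne[OF w] by (simp add: norm_divide)
  qed
  have "norm (v z) \<le> norm z"
    using Schwarz_Lemma(1)[OF hv] v_lt z p0 by (simp add: v_def)
  hence inv: "1 / norm (p z) \<ge> 1 - norm z"
    using norm_triangle_ineq2[of 1 "v z"] by (simp add: v_def norm_divide)
  have pz: "norm (p z) > 0" using ne[OF z] by simp
  have z1: "norm z < 1" using z by simp
  have z2: "1 - (norm z)\<^sup>2 = (1 - norm z) * (1 + norm z)"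
    by (simp add: power2_eq_square algebra_simps)
  have "deriv (\<lambda>w. 2 * p w - 1) z = 2 * deriv p z"
    by (rule DERIV_imp_deriv) (use hp z in \<open>auto intro!: derivative_eq_intros holomorphic_derivI\<close>)
  moreover have "norm (deriv (\<lambda>w. 2 * p w - 1) z) \<le> 2 * Re (2 * p z - 1) / (1 - (norm z)\<^sup>2)"
    using half hp z by (intro norm_deriv_positive_real_part_le) (auto intro!: holomorphic_intros)
  moreover have "(norm z)\<^sup>2 < 1" using z1 by (simp add: abs_square_less_1)
  ultimately have "norm (deriv p z) \<le> (2 * Re (p z) - 1) / (1 - (norm z)\<^sup>2)"
    by (simp add: norm_mult field_simps)
  also have "\<dots> \<le> (2 * norm (p z) - 1) / (1 - (norm z)\<^sup>2)"
    using z1 complex_Re_le_cmod[of "p z"] unfolding z2 by (intro divide_right_mono) auto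
  also have "\<dots> = norm (p z) * ((2 - 1 / norm (p z)) / (1 - (norm z)\<^sup>2))"
    using pz by (simp add: right_diff_distrib mult.commute)
  also have "\<dots> \<le> norm (p z) * ((1 + norm z) / (1 - (norm z)\<^sup>2))"
    using inv z1 unfolding z2 by (intro mult_left_mono divide_right_mono) auto
  also have "(1 + norm z) / (1 - (norm z)\<^sup>2) = 1 / (1 - norm z)"
    unfolding z2 using z1 norm_ge_zero[of z] by (auto simp: divide_simps add_nonneg_eq_0_iff)
  finally show ?thesis using pz by (simp add: norm_divide field_simps)
qed

section \<open>The image of the disc under the rational function\<close>

text \<open>
  The constant \<open>k\<close> of \<open>psi\<close>. Because of \<open>k\<^sup>2 = 2 k + 1\<close>, the distance from \<open>1\<close> to \<open>psi (-1)\<close>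
  is \<open>1 / k\<^sup>2\<close>.
\<close>

definition silver_ratio :: real where "silver_ratio = sqrt 2 + 1"

lemma silver_ratio_gt_1: "silver_ratio > 1"
  by (simp add: silver_ratio_def)

lemma silver_ratio_square: "silver_ratio\<^sup>2 = 2 * silver_ratio + 1"
  by (simp add: silver_ratio_def power2_eq_square algebra_simps)

lemma inverse_silver_ratio_square: "1 / silver_ratio\<^sup>2 = 3 - 2 * sqrt 2"
proof -
  have "(3 - 2 * sqrt 2) * silver_ratio\<^sup>2 = 1"
    by (simp add: silver_ratio_def power2_eq_square algebra_simps)
  thus ?thesis using silver_ratio_gt_1 by (simp add: field_simps)
qed

lemma psi_eq:
  "psi z = 1 + z * (of_real silver_ratio + z) / (of_real silver_ratio * (of_real silver_ratio - z))"
  by (simp add: psi_def silver_ratio_def Let_def power2_eq_square algebra_simps)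

lemma psi_holomorphic: "psi holomorphic_on unit_disc"
proof -
  have "of_real silver_ratio \<noteq> z" if "norm z < 1" for z :: complex
    using that silver_ratio_gt_1 by auto
  thus ?thesis
    unfolding psi_eq[abs_def] using silver_ratio_gt_1 by (intro holomorphic_intros) auto
qed

text \<open>
  The value is \<open>psi (-1)\<close>. The equation for its preimages is
  quadratic in \<open>z\<close>, and \<open>k\<^sup>2 = 2 k + 1\<close> turns it into \<open>k (z + 1)\<^sup>2 = 0\<close>.
\<close>

lemma psi_value_at_minus_1_not_attained:
  assumes "z \<in> unit_disc"
  shows "psi z \<noteq> 1 - of_real (1 / silver_ratio\<^sup>2)"
proof
  define k where "k = complex_of_real silver_ratio"
  have k2: "k\<^sup>2 = 2 * k + 1"
    using arg_cong[OF silver_ratio_square, of complex_of_real] by (simp add: k_def)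
  have k0: "k \<noteq> 0" using silver_ratio_gt_1 by (simp add: k_def)
  have kz: "k \<noteq> z" using assms silver_ratio_gt_1 by (auto simp: k_def)
  assume "psi z = 1 - of_real (1 / silver_ratio\<^sup>2)"
  hence "z * (k + z) / (k * (k - z)) = - (1 / k\<^sup>2)"
    by (simp add: psi_eq k_def)
  hence "z * (k + z) * k\<^sup>2 = - (k * (k - z))"
    using k0 kz by (simp add: divide_simps)
  hence "k * (z * (k + z) * k + k - z) = 0" by (simp add: power2_eq_square algebra_simps)
  hence "z * (k + z) * k + k - z = 0" using k0 by simp
  hence "k * (z + 1)\<^sup>2 + (k\<^sup>2 - 2 * k - 1) * z = 0" by (simp add: power2_eq_square algebra_simps)
  hence "z = - 1" using k0 k2 by (simp add: eq_neg_iff_add_eq_0)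
  thus False using assms by simp
qed

text \<open>
  Solving \<open>psi w = 1 + u\<close> gives \<open>w\<^sup>2 + k (1 + u) w - k\<^sup>2 u = 0\<close>, with discriminant
  \<open>k\<^sup>2 (1 + 6 u + u\<^sup>2) = k\<^sup>2 (1 + k\<^sup>2 u) (1 + u / k\<^sup>2)\<close>. For \<open>|u| < 1 / k\<^sup>2\<close> both factors after
  \<open>k\<^sup>2\<close> have positive real part, so the product of their principal square roots is holomorphic.
  The solution stays in the unit disc by connectedness: if \<open>|w| = 1\<close>, then
  \<open>|psi w - 1| = |k + w| / (k |k - w|) \<ge> (k - 1) / (k (k + 1)) = 1 / k\<^sup>2\<close>, so \<open>|w|\<close> never equals
  \<open>1\<close>, and it starts from \<open>0\<close> at \<open>u = 0\<close>.
\<close>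

lemma psi_right_inverse:
  obtains W where "W holomorphic_on ball 0 (1 / silver_ratio\<^sup>2)" "W 0 = 0"
    "\<And>u. u \<in> ball 0 (1 / silver_ratio\<^sup>2) \<Longrightarrow> norm (W u) < 1 \<and> psi (W u) = 1 + u"
proof -
  define k where "k = complex_of_real silver_ratio"
  define B where "B = (ball 0 (1 / silver_ratio\<^sup>2) :: complex set)"
  define s where "s = (\<lambda>u. csqrt (1 + k\<^sup>2 * u) * csqrt (1 + u / k\<^sup>2))"
  define W where "W = (\<lambda>u. k / 2 * (s u - 1 - u))"
  note k_gt_1 = silver_ratio_gt_1
  have k0: "k \<noteq> 0" using k_gt_1 by (simp add: k_def)
  have k2: "k\<^sup>2 = 2 * k + 1"
    using arg_cong[OF silver_ratio_square, of complex_of_real] by (simp add: k_def)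
  have nk: "norm k = silver_ratio" using k_gt_1 by (simp add: k_def)
  have k2_gt_1: "silver_ratio\<^sup>2 > 1" using k_gt_1 by (simp add: one_less_power)
  have slit: "1 + k\<^sup>2 * u \<notin> \<real>\<^sub>\<le>\<^sub>0" "1 + u / k\<^sup>2 \<notin> \<real>\<^sub>\<le>\<^sub>0" if "u \<in> B" for u
  proof -
    have pos: "1 + v \<notin> \<real>\<^sub>\<le>\<^sub>0" if "norm v < 1" for v :: complex
      using that abs_Re_le_cmod[of v] by (auto simp: complex_nonpos_Reals_iff)
    have u: "norm u < 1 / silver_ratio\<^sup>2" using that by (simp add: B_def)
    show "1 + k\<^sup>2 * u \<notin> \<real>\<^sub>\<le>\<^sub>0"
      using u order_less_trans[OF zero_less_one k2_gt_1]
      by (intro pos) (simp only: norm_mult norm_power nk pos_less_divide_eq mult.commute)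
    have "1 / silver_ratio\<^sup>2 < 1" using k2_gt_1 by (subst pos_divide_less_eq) auto
    hence "norm u < silver_ratio\<^sup>2" using u k2_gt_1 by linarith
    thus "1 + u / k\<^sup>2 \<notin> \<real>\<^sub>\<le>\<^sub>0"
      using order_less_trans[OF zero_less_one k2_gt_1]
      by (intro pos) (simp only: norm_divide norm_power nk pos_divide_less_eq mult_1)
  qed
  have hs: "s holomorphic_on B"
    unfolding s_def using slit k0 by (intro holomorphic_intros) auto
  hence hW: "W holomorphic_on B"
    unfolding W_def by (intro holomorphic_intros) auto
  have W0: "W 0 = 0" by (simp add: W_def s_def)
  have quad: "W u * (k + W u) = u * k * (k - W u)" for u
  proof -
    have "(k\<^sup>2)\<^sup>2 + 1 = 6 * k\<^sup>2"
      using k2 by algebra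
    hence "k\<^sup>2 + 1 / k\<^sup>2 = 6" using k0 by (simp add: field_simps power2_eq_square)
    moreover have "(s u)\<^sup>2 = 1 + (k\<^sup>2 + 1 / k\<^sup>2) * u + u\<^sup>2"
    proof -
      have "(s u)\<^sup>2 = (1 + k\<^sup>2 * u) * (1 + u / k\<^sup>2)" by (simp add: s_def power_mult_distrib)
      thus ?thesis using k0 by (simp add: field_simps power2_eq_square)
    qed
    ultimately have "(s u)\<^sup>2 = 1 + 6 * u + u\<^sup>2" by simp
    thus ?thesis unfolding W_def by (simp add: field_simps power2_eq_square)
  qed
  have psi_W: "psi (W u) = 1 + u" for u
  proof -
    have "W u \<noteq> k" using quad[of u] k0 by auto
    thus ?thesis using quad[of u] k0 by (simp add: psi_eq k_def[symmetric] field_simps)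
  qed
  have W_ne: "norm (W u) \<noteq> 1" if "u \<in> B" for u
  proof
    assume W1: "norm (W u) = 1"
    have "norm (k + W u) \<ge> silver_ratio - 1"
      using norm_diff_ineq[of k "W u"] by (simp add: nk W1)
    also have "norm (k + W u) = norm u * (silver_ratio * norm (k - W u))"
      using arg_cong[OF quad[of u], of norm] by (simp add: norm_mult W1 nk)
    also have "\<dots> \<le> norm u * (silver_ratio * (silver_ratio + 1))"
      using norm_triangle_ineq4[of k "W u"] k_gt_1 by (intro mult_left_mono) (auto simp: nk W1)
    also have "\<dots> < 1 / silver_ratio\<^sup>2 * (silver_ratio * (silver_ratio + 1))"
      using that k_gt_1 by (intro mult_strict_right_mono) (auto simp: B_def)
    also have "silver_ratio + 1 = silver_ratio * (silver_ratio - 1)"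
      using silver_ratio_square by (simp add: power2_eq_square algebra_simps)
    finally show False using k_gt_1 by (simp add: power2_eq_square)
  qed
  have W_lt: "norm (W u) < 1" if "u \<in> B" for u
  proof (rule ccontr)
    assume "\<not> norm (W u) < 1"
    have conn: "connected ((\<lambda>u. norm (W u)) ` B)"
      using hW unfolding B_def
      by (intro connected_continuous_image continuous_on_norm holomorphic_on_imp_continuous_on) auto
    have "0 \<in> B" using k_gt_1 by (simp add: B_def)
    hence "1 \<in> (\<lambda>u. norm (W u)) ` B"
      using \<open>\<not> norm (W u) < 1\<close> W0
      by (intro connectedD_interval[OF conn imageI[of 0] imageI[OF that]]) auto
    thus False using W_ne by auto
  qed
  show ?thesis
    using hW W0 W_lt psi_W by (intro that[of W]) (auto simp: B_def)
qed

lemma subordinate_psi_if_near_1: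
  assumes h: "h holomorphic_on unit_disc" and h0: "h 0 = 1"
    and near: "\<And>z. z \<in> unit_disc \<Longrightarrow> norm (h z - 1) < 1 / silver_ratio\<^sup>2"
  shows "subordinate h psi"
proof -
  obtain W where W: "W holomorphic_on ball 0 (1 / silver_ratio\<^sup>2)" "W 0 = 0"
    "\<And>u. u \<in> ball 0 (1 / silver_ratio\<^sup>2) \<Longrightarrow> norm (W u) < 1 \<and> psi (W u) = 1 + u"
    using psi_right_inverse by blast
  have in_ball: "h z - 1 \<in> ball 0 (1 / silver_ratio\<^sup>2)" if "z \<in> unit_disc" for z
    using near[OF that] by simp
  have "(W \<circ> (\<lambda>z. h z - 1)) holomorphic_on unit_disc"
    using in_ball by (intro holomorphic_on_compose_gen[OF _ W(1)] holomorphic_intros h) auto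
  moreover have "\<forall>z\<in>unit_disc. norm ((W \<circ> (\<lambda>z. h z - 1)) z) < 1 \<and> h z = psi ((W \<circ> (\<lambda>z. h z - 1)) z)"
    using W(3)[OF in_ball] by simp
  ultimately show ?thesis
    unfolding subordinate_def using h psi_holomorphic h0 W(2)
    by (intro conjI exI[of _ "W \<circ> (\<lambda>z. h z - 1)"]) (auto simp del: o_apply, simp)
qed

section \<open>Dilations and starlikeness\<close>

definition dilation :: "real \<Rightarrow> (complex \<Rightarrow> complex) \<Rightarrow> complex \<Rightarrow> complex"
  where "dilation r f = (\<lambda>z. f (of_real r * z) / of_real r)"

lemma of_real_mult_in_unit_disc:
  assumes "0 < r" "r < 1" "z \<in> unit_disc"
  shows "of_real r * z \<in> unit_disc"
proof -
  have "r * norm z \<le> norm z" using assms by (intro mult_left_le_one_le) auto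
  thus ?thesis using assms by (simp add: norm_mult)
qed

lemma holomorphic_on_rescale:
  assumes "F holomorphic_on unit_disc" "0 < r" "r < 1"
  shows "(\<lambda>z. F (of_real r * z)) holomorphic_on unit_disc"
  using holomorphic_on_compose_gen[of "\<lambda>z. of_real r * z" unit_disc F unit_disc] assms
    of_real_mult_in_unit_disc[OF assms(2,3)]
  by (auto simp: o_def image_subset_iff intro!: holomorphic_intros)

text \<open>
  For \<open>f z = z * P z\<close> the starlikeness quotient is \<open>1 + z P'(z) / P(z)\<close>, and dilating \<open>f\<close> only
  rescales its argument.
\<close>

lemma dilation_log_deriv:
  assumes P: "P holomorphic_on unit_disc"
    and f: "\<forall>z\<in>unit_disc. P z \<noteq> 0 \<and> f z = z * P z"
    and r: "0 < r" "r < 1" and z: "z \<in> unit_disc"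
  defines "\<zeta> \<equiv> of_real r * z"
  shows "dilation r f z = z * P \<zeta>"
    and "(dilation r f has_field_derivative P \<zeta> + \<zeta> * deriv P \<zeta>) (at z)"
    and "remove_sings (\<lambda>z. z * deriv (dilation r f) z / dilation r f z) z = 1 + \<zeta> * deriv P \<zeta> / P \<zeta>"
proof -
  let ?r = "of_real r :: complex"
  note rz = of_real_mult_in_unit_disc[OF r]
  have eq: "dilation r f w = w * P (?r * w)" if "w \<in> unit_disc" for w
    using f rz[OF that] r by (simp add: dilation_def)
  thus "dilation r f z = z * P \<zeta>" using z by (simp add: \<zeta>_def)
  have D: "(dilation r f has_field_derivative P (?r * w) + ?r * w * deriv P (?r * w)) (at w)"
    if w: "w \<in> unit_disc" for w
  proof -
    have dP: "(P has_field_derivative deriv P (?r * w)) (at (?r * w))"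
      using P rz[OF w] by (auto intro: holomorphic_derivI)
    have "((\<lambda>w. P (?r * w)) has_field_derivative deriv P (?r * w) * ?r) (at w)"
      by (rule DERIV_chain2[where g = "\<lambda>w. ?r * w", OF dP]) (auto intro!: derivative_eq_intros)
    hence "((\<lambda>w. w * P (?r * w)) has_field_derivative P (?r * w) + ?r * w * deriv P (?r * w)) (at w)"
      by (auto intro!: derivative_eq_intros simp: algebra_simps)
    thus ?thesis
      by (rule has_field_derivative_transform_within_open[where S = unit_disc]) (use w eq in auto)
  qed
  thus "(dilation r f has_field_derivative P \<zeta> + \<zeta> * deriv P \<zeta>) (at z)"
    using z by (simp add: \<zeta>_def)
  have hP: "(\<lambda>w. P (?r * w)) holomorphic_on unit_disc"
    "(\<lambda>w. deriv P (?r * w)) holomorphic_on unit_disc"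
    using P holomorphic_deriv[OF P] r by (auto intro: holomorphic_on_rescale)
  show "remove_sings (\<lambda>z. z * deriv (dilation r f) z / dilation r f z) z = 1 + \<zeta> * deriv P \<zeta> / P \<zeta>"
    unfolding \<zeta>_def
  proof (rule remove_sings_quotientI[where h = "\<lambda>z. 1 + ?r * z * deriv P (?r * z) / P (?r * z)"])
    show "(\<lambda>z. 1 + ?r * z * deriv P (?r * z) / P (?r * z)) holomorphic_on unit_disc"
      using hP f rz by (intro holomorphic_intros) auto
    fix w assume w: "w \<in> unit_disc" "w \<noteq> 0"
    show "dilation r f w \<noteq> 0 \<and> w * deriv (dilation r f) w =
        dilation r f w * (1 + ?r * w * deriv P (?r * w) / P (?r * w))"
      using w f rz[OF w(1)] DERIV_imp_deriv[OF D[OF w(1)]] eq[OF w(1)]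
      by (simp add: field_simps)
  qed (rule z)
qed

lemma dilation_in_S_R:
  assumes P: "P holomorphic_on unit_disc" "P 0 = 1"
    and f: "\<forall>z\<in>unit_disc. P z \<noteq> 0 \<and> f z = z * P z"
    and r: "0 < r" "r < 1"
    and near: "\<And>z. norm z < r \<Longrightarrow> norm (z * deriv P z / P z) < 1 / silver_ratio\<^sup>2"
  shows "dilation r f \<in> S_R"
proof -
  let ?r = "of_real r :: complex"
  note L = dilation_log_deriv[OF P(1) f r]
  let ?q = "remove_sings (\<lambda>z. z * deriv (dilation r f) z / dilation r f z)"
  note rz = of_real_mult_in_unit_disc[OF r]
  have "dilation r f holomorphic_on unit_disc"
    using L(2) unfolding holomorphic_on_open[OF open_ball] by blast
  moreover have "deriv (dilation r f) 0 = 1"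
    using DERIV_imp_deriv[OF L(2)[of 0]] P(2) by simp
  moreover have "dilation r f 0 = 0" using L(1)[of 0] by simp
  moreover have "subordinate ?q psi"
  proof (rule subordinate_psi_if_near_1)
    have hP: "(\<lambda>w. P (?r * w)) holomorphic_on unit_disc"
      "(\<lambda>w. deriv P (?r * w)) holomorphic_on unit_disc"
      using P(1) holomorphic_deriv[OF P(1)] r by (auto intro: holomorphic_on_rescale)
    have "(\<lambda>z. 1 + ?r * z * deriv P (?r * z) / P (?r * z)) holomorphic_on unit_disc"
      using hP f rz by (intro holomorphic_intros) auto
    thus "?q holomorphic_on unit_disc"
      by (rule holomorphic_transform) (use L(3) in auto)
    show "?q 0 = 1" using L(3)[of 0] by simp
    fix z assume z: "z \<in> unit_disc"
    have "norm (?r * z) < r" using z r by (simp add: norm_mult)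
    thus "norm (?q z - 1) < 1 / silver_ratio\<^sup>2"
      using near L(3)[OF z] by simp
  qed
  ultimately show ?thesis by (simp add: S_R_def starlike_class_def normalized_def)
qed

text \<open>
  The dilation by \<open>r > |a|\<close> still sees the point \<open>a\<close>, where the starlikeness quotient takes the
  value that \<open>psi\<close> omits.
\<close>

lemma dilation_not_in_S_R:
  assumes P: "P holomorphic_on unit_disc"
    and f: "\<forall>z\<in>unit_disc. P z \<noteq> 0 \<and> f z = z * P z"
    and r: "r < 1" "norm a < r"
    and a: "a * deriv P a / P a = - of_real (1 / silver_ratio\<^sup>2)"
  shows "dilation r f \<notin> S_R"
proof
  have r0: "0 < r" using r norm_ge_zero[of a] by linarith
  define z where "z = a / of_real r"
  have z: "z \<in> unit_disc" "of_real r * z = a" using r r0 by (auto simp: z_def norm_divide)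
  assume "dilation r f \<in> S_R"
  then obtain w where "w ` unit_disc \<subseteq> unit_disc"
    "\<forall>z\<in>unit_disc. remove_sings (\<lambda>z. z * deriv (dilation r f) z / dilation r f z) z = psi (w z)"
    unfolding S_R_def starlike_class_def subordinate_def by auto
  hence "w z \<in> unit_disc" "psi (w z) = 1 - of_real (1 / silver_ratio\<^sup>2)"
    using dilation_log_deriv(3)[OF P f r0 r(1) z(1)] z a by (auto simp: image_subset_iff)
  thus False using psi_value_at_minus_1_not_attained by blast
qed

section \<open>Admissible radii\<close>

text \<open>
  The quotient is increasing in \<open>x\<close>, and equals \<open>c\<close> at \<open>x = R\<close>.
\<close>

lemma quadratic_quotient_less:
  assumes "a > 0" "b \<ge> 0" "c > 0" "R < 1" "a * R + b * R\<^sup>2 = c * (1 - R\<^sup>2)" "0 \<le> x" "x < R"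
  shows "(a * x + b * x\<^sup>2) / (1 - x\<^sup>2) < (c::real)"
proof -
  have sq: "x\<^sup>2 \<le> R\<^sup>2" using assms by (intro power_mono) auto
  have "R\<^sup>2 < 1" using assms by (simp add: abs_square_less_1)
  have "a * x + b * x\<^sup>2 < a * R + b * R\<^sup>2"
    using assms sq by (intro add_less_le_mono mult_left_mono) auto
  also have "\<dots> \<le> c * (1 - x\<^sup>2)" unfolding assms(5) using assms(3) sq by (intro mult_left_mono) auto
  finally show ?thesis using sq \<open>R\<^sup>2 < 1\<close> by (simp add: pos_divide_less_eq)
qed

lemma admissible_radius_if_log_deriv_lt:
  assumes R: "0 < R" "R < 1"
    and F: "\<And>f. f \<in> F \<Longrightarrow> \<exists>P. P holomorphic_on unit_disc \<and> P 0 = 1 \<and>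
      (\<forall>z\<in>unit_disc. P z \<noteq> 0 \<and> f z = z * P z) \<and>
      (\<forall>z. norm z < R \<longrightarrow> norm (z * deriv P z / P z) < 1 / silver_ratio\<^sup>2)"
  shows "R \<in> admissible_radii S_R F"
proof -
  have "dilation r f \<in> S_R" if "f \<in> F" "0 < r" "r < R" for f r
    using F[OF that(1)] that R by (auto intro!: dilation_in_S_R)
  thus ?thesis using R by (simp add: admissible_radii_def dilation_def)
qed

lemma admissible_radius_if_log_deriv_bound:
  fixes \<alpha> \<beta> R :: real
  assumes F: "\<And>f. f \<in> F \<Longrightarrow> \<exists>P. P holomorphic_on unit_disc \<and> P 0 = 1 \<and>
      (\<forall>z\<in>unit_disc. P z \<noteq> 0 \<and> f z = z * P z) \<and>
      (\<forall>z\<in>unit_disc. norm (z * deriv P z / P z) \<le> (\<alpha> * norm z + \<beta> * (norm z)\<^sup>2) / (1 - (norm z)\<^sup>2))"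
    and R: "0 < R" "R < 1" and \<alpha>\<beta>: "\<alpha> > 0" "\<beta> \<ge> 0"
    and eq: "\<alpha> * R + \<beta> * R\<^sup>2 = 1 / silver_ratio\<^sup>2 * (1 - R\<^sup>2)"
  shows "R \<in> admissible_radii S_R F"
proof (rule admissible_radius_if_log_deriv_lt[OF R])
  fix f assume "f \<in> F"
  then obtain P where P: "P holomorphic_on unit_disc" "P 0 = 1"
    "\<forall>z\<in>unit_disc. P z \<noteq> 0 \<and> f z = z * P z"
    and le: "\<And>z. z \<in> unit_disc \<Longrightarrow>
      norm (z * deriv P z / P z) \<le> (\<alpha> * norm z + \<beta> * (norm z)\<^sup>2) / (1 - (norm z)\<^sup>2)"
    using F by blast
  have "norm (z * deriv P z / P z) < 1 / silver_ratio\<^sup>2" if "norm z < R" for z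
  proof -
    have "(\<alpha> * norm z + \<beta> * (norm z)\<^sup>2) / (1 - (norm z)\<^sup>2) < 1 / silver_ratio\<^sup>2"
      using silver_ratio_gt_1 that R by (intro quadratic_quotient_less[OF \<alpha>\<beta> _ R(2) eq]) auto
    thus ?thesis using le[of z] that R by auto
  qed
  thus "\<exists>P. P holomorphic_on unit_disc \<and> P 0 = 1 \<and> (\<forall>z\<in>unit_disc. P z \<noteq> 0 \<and> f z = z * P z) \<and>
      (\<forall>z. norm z < R \<longrightarrow> norm (z * deriv P z / P z) < 1 / silver_ratio\<^sup>2)"
    using P by blast
qed

lemma admissible_radius_le_norm:
  assumes R': "R' \<in> admissible_radii S_R F" and f: "f \<in> F"
    and P: "P holomorphic_on unit_disc" "\<forall>z\<in>unit_disc. P z \<noteq> 0 \<and> f z = z * P z"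
    and a: "a * deriv P a / P a = - of_real (1 / silver_ratio\<^sup>2)"
  shows "R' \<le> norm a"
proof (rule ccontr)
  assume "\<not> R' \<le> norm a"
  then obtain r where r: "norm a < r" "r < R'" using dense[of "norm a" R'] by auto
  have "R' < 1" using R' by (simp add: admissible_radii_def)
  moreover have "dilation r f \<in> S_R"
    using R' f r le_less_trans[OF norm_ge_zero r(1)] by (auto simp: admissible_radii_def dilation_def)
  ultimately show False
    using dilation_not_in_S_R[OF P _ r(1) a] r by auto
qed

text \<open>
  The set of admissible numbers is closed under suprema below \<open>1\<close>, as the condition on \<open>r\<close> is
  required only for \<open>r < R\<close>. So a largest admissible number exists once a bound \<open>B < 1\<close> is known.
\<close>

lemma is_class_radius_Sup:
  assumes "R \<in> admissible_radii \<G> F" "B < 1" "\<And>R'. R' \<in> admissible_radii \<G> F \<Longrightarrow> R' \<le> B"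
  shows "\<exists>R'\<ge>R. is_class_radius \<G> F R'"
proof -
  define S where "S = Sup (admissible_radii \<G> F)"
  have bdd: "bdd_above (admissible_radii \<G> F)" using assms(3) by (rule bdd_aboveI)
  have le: "R' \<le> S" if "R' \<in> admissible_radii \<G> F" for R'
    unfolding S_def using that bdd by (rule cSup_upper)
  have "S \<le> B" unfolding S_def using assms(1,3) by (intro cSup_least) auto
  moreover have "0 < S" using le[OF assms(1)] assms(1) by (simp add: admissible_radii_def)
  moreover have "(\<lambda>z. f (of_real r * z) / of_real r) \<in> \<G>" if r: "f \<in> F" "0 < r" "r < S" for f r
  proof -
    obtain R' where "R' \<in> admissible_radii \<G> F" "r < R'"
      using less_cSupD[of "admissible_radii \<G> F" r] r(3) assms(1) by (auto simp: S_def)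
    thus ?thesis using r by (auto simp: admissible_radii_def)
  qed
  ultimately have "S \<in> admissible_radii \<G> F" using assms(2) by (auto simp: admissible_radii_def)
  thus ?thesis using le assms(1) unfolding is_class_radius_def by blast
qed

section \<open>Logarithmic derivatives in the three classes\<close>

text \<open>
  Hence the denominators \<open>z * p z\<close> of the class definitions fall under
  \<open>eq_mult_remove_sings_quotient\<close>.
\<close>

lemma mult_caratheodory_normalized:
  assumes "p \<in> caratheodory"
  shows "(\<lambda>z. z * p z) \<in> normalized"
proof -
  have p: "p holomorphic_on unit_disc" "p 0 = 1" using assms by (auto simp: caratheodory_def)
  have "((\<lambda>z. z * p z) has_field_derivative 1) (at 0)"
    by (rule derivative_eq_intros holomorphic_derivI[OF p(1)] refl | simp add: p(2))+
  thus ?thesis using p by (auto simp: normalized_def DERIV_imp_deriv intro!: holomorphic_intros)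
qed

lemma two_step_factorization:
  assumes "f \<in> normalized" "g \<in> normalized" "p \<in> caratheodory"
    and "remove_sings (\<lambda>z. f z / g z) \<in> caratheodory"
    and "remove_sings (\<lambda>z. g z / (z * p z)) \<in> caratheodory" and "z \<in> unit_disc"
  shows "f z = z * (p z * (remove_sings (\<lambda>z. f z / g z) z * remove_sings (\<lambda>z. g z / (z * p z)) z))"
  using eq_mult_remove_sings_quotient[of f g z] assms mult_caratheodory_normalized[OF assms(3)]
    eq_mult_remove_sings_quotient[of g "\<lambda>z. z * p z" z]
  by (simp add: normalized_def caratheodory_def)

lemma G1_factorization:
  assumes "f \<in> G1"
  obtains p q h where "p \<in> caratheodory" "q \<in> caratheodory" "h \<in> caratheodory"
    "\<And>z. z \<in> unit_disc \<Longrightarrow> f z = z * (p z * (q z * h z))"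
  using assms unfolding G1_def by (blast intro: two_step_factorization)

lemma G2_factorization:
  assumes "f \<in> G2"
  obtains p q h where "p \<in> caratheodory" "q \<in> caratheodory" "h \<in> caratheodory_half"
    "\<And>z. z \<in> unit_disc \<Longrightarrow> f z = z * (p z * (q z * h z))"
  using assms unfolding G2_def caratheodory_half_def by (blast intro: two_step_factorization)

lemma G3_factorization:
  assumes "f \<in> G3"
  obtains p q where "p \<in> caratheodory" "q \<in> caratheodory"
    "\<And>z. z \<in> unit_disc \<Longrightarrow> f z = z * (p z * q z)"
proof -
  obtain p where p: "p \<in> caratheodory" "remove_sings (\<lambda>z. f z / (z * p z)) \<in> caratheodory"
    and f: "f \<in> normalized"
    using assms by (auto simp: G3_def)
  show ?thesis
  proof (rule that[OF p])
    fix z :: complex assume "z \<in> unit_disc"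
    thus "f z = z * (p z * remove_sings (\<lambda>z. f z / (z * p z)) z)"
      using eq_mult_remove_sings_quotient[of f "\<lambda>z. z * p z" z] f p mult_caratheodory_normalized[OF p(1)]
      by (simp add: normalized_def caratheodory_def)
  qed
qed

lemma logarithmic_derivative_mult:
  fixes f g :: "complex \<Rightarrow> complex"
  assumes "f holomorphic_on S" "g holomorphic_on S" "open S" "z \<in> S" "f z \<noteq> 0" "g z \<noteq> 0"
  shows "deriv (\<lambda>z. f z * g z) z / (f z * g z) = deriv f z / f z + deriv g z / g z"
  using assms by (simp add: holomorphic_on_imp_differentiable_at field_simps)

lemma norm_log_deriv_mult_le:
  assumes "p holomorphic_on unit_disc" "q holomorphic_on unit_disc" "z \<in> unit_disc" "p z \<noteq> 0" "q z \<noteq> 0"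
    and "norm (deriv p z / p z) \<le> A" "norm (deriv q z / q z) \<le> B"
  shows "norm (deriv (\<lambda>z. p z * q z) z / (p z * q z)) \<le> A + B"
proof -
  have "deriv (\<lambda>z. p z * q z) z / (p z * q z) = deriv p z / p z + deriv q z / q z"
    using assms by (intro logarithmic_derivative_mult[where S = unit_disc]) auto
  thus ?thesis using norm_triangle_mono[OF assms(6,7)] by simp
qed

lemma G1_log_deriv_bound:
  assumes "f \<in> G1"
  shows "\<exists>P. P holomorphic_on unit_disc \<and> P 0 = 1 \<and> (\<forall>z\<in>unit_disc. P z \<noteq> 0 \<and> f z = z * P z) \<and>
    (\<forall>z\<in>unit_disc. norm (z * deriv P z / P z) \<le> 6 * norm z / (1 - (norm z)\<^sup>2))"
proof -
  obtain p q h where c: "p \<in> caratheodory" "q \<in> caratheodory" "h \<in> caratheodory"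
    and f: "\<And>z. z \<in> unit_disc \<Longrightarrow> f z = z * (p z * (q z * h z))"
    using G1_factorization[OF assms] by blast
  have hol: "p holomorphic_on unit_disc" "q holomorphic_on unit_disc" "h holomorphic_on unit_disc"
    and "p 0 = 1" "q 0 = 1" "h 0 = 1"
    using c by (auto simp: caratheodory_def)
  have "norm (z * deriv (\<lambda>z. p z * (q z * h z)) z / (p z * (q z * h z))) \<le> 6 * norm z / (1 - (norm z)\<^sup>2)"
    if z: "z \<in> unit_disc" for z
  proof -
    let ?B = "2 / (1 - (norm z)\<^sup>2)"
    have "norm (deriv (\<lambda>z. p z * (q z * h z)) z / (p z * (q z * h z))) \<le> ?B + (?B + ?B)"
      using c z hol
      by (intro norm_log_deriv_mult_le norm_log_deriv_caratheodory_le holomorphic_intros)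
        (auto simp: caratheodory_ne_0)
    hence "norm z * norm (deriv (\<lambda>z. p z * (q z * h z)) z / (p z * (q z * h z))) \<le> norm z * (?B + (?B + ?B))"
      by (rule mult_left_mono) simp
    thus ?thesis by (simp add: norm_mult norm_divide mult.commute)
  qed
  thus ?thesis using c f hol \<open>p 0 = 1\<close> \<open>q 0 = 1\<close> \<open>h 0 = 1\<close>
    by (intro exI[of _ "\<lambda>z. p z * (q z * h z)"]) (auto simp: caratheodory_ne_0 intro!: holomorphic_intros)
qed

text \<open>
  The bound is \<open>2 * 2 r / (1 - r\<^sup>2) + r / (1 - r)\<close> over the common denominator.
\<close>

lemma G2_log_deriv_bound:
  assumes "f \<in> G2"
  shows "\<exists>P. P holomorphic_on unit_disc \<and> P 0 = 1 \<and> (\<forall>z\<in>unit_disc. P z \<noteq> 0 \<and> f z = z * P z) \<and>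
    (\<forall>z\<in>unit_disc. norm (z * deriv P z / P z) \<le> (5 * norm z + (norm z)\<^sup>2) / (1 - (norm z)\<^sup>2))"
proof -
  obtain p q h where c: "p \<in> caratheodory" "q \<in> caratheodory" "h \<in> caratheodory_half"
    and f: "\<And>z. z \<in> unit_disc \<Longrightarrow> f z = z * (p z * (q z * h z))"
    using G2_factorization[OF assms] by blast
  have h: "h \<in> caratheodory" using c(3) by (simp add: caratheodory_half_def)
  have hol: "p holomorphic_on unit_disc" "q holomorphic_on unit_disc" "h holomorphic_on unit_disc"
    and "p 0 = 1" "q 0 = 1" "h 0 = 1"
    using c h by (auto simp: caratheodory_def)
  have "norm (z * deriv (\<lambda>z. p z * (q z * h z)) z / (p z * (q z * h z)))
      \<le> (5 * norm z + (norm z)\<^sup>2) / (1 - (norm z)\<^sup>2)"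
    if z: "z \<in> unit_disc" for z
  proof -
    let ?B = "2 / (1 - (norm z)\<^sup>2)" and ?C = "1 / (1 - norm z)"
    have "norm (deriv (\<lambda>z. p z * (q z * h z)) z / (p z * (q z * h z))) \<le> ?B + (?B + ?C)"
      using c h z hol
      by (intro norm_log_deriv_mult_le norm_log_deriv_caratheodory_le
          norm_log_deriv_caratheodory_half_le holomorphic_intros)
        (auto simp: caratheodory_ne_0)
    hence "norm z * norm (deriv (\<lambda>z. p z * (q z * h z)) z / (p z * (q z * h z))) \<le> norm z * (?B + (?B + ?C))"
      by (rule mult_left_mono) simp
    also have "norm z * (?B + (?B + ?C)) = (5 * norm z + (norm z)\<^sup>2) / (1 - (norm z)\<^sup>2)"
    proof -
      have "1 - (norm z)\<^sup>2 = (1 - norm z) * (1 + norm z)"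
        by (simp add: power2_eq_square algebra_simps)
      moreover have "1 + norm z > 0" by (simp add: add_pos_nonneg)
      ultimately have "?C = (1 + norm z) / (1 - (norm z)\<^sup>2)" by simp
      hence "norm z * (?B + (?B + ?C)) = norm z * (2 + (2 + (1 + norm z))) / (1 - (norm z)\<^sup>2)"
        by (simp add: add_divide_distrib[symmetric])
      also have "norm z * (2 + (2 + (1 + norm z))) = 5 * norm z + (norm z)\<^sup>2"
        by (simp add: power2_eq_square algebra_simps)
      finally show ?thesis .
    qed
    finally show ?thesis by (simp add: norm_mult norm_divide)
  qed
  thus ?thesis using c h f hol \<open>p 0 = 1\<close> \<open>q 0 = 1\<close> \<open>h 0 = 1\<close>
    by (intro exI[of _ "\<lambda>z. p z * (q z * h z)"]) (auto simp: caratheodory_ne_0 intro!: holomorphic_intros)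
qed

lemma G3_log_deriv_bound:
  assumes "f \<in> G3"
  shows "\<exists>P. P holomorphic_on unit_disc \<and> P 0 = 1 \<and> (\<forall>z\<in>unit_disc. P z \<noteq> 0 \<and> f z = z * P z) \<and>
    (\<forall>z\<in>unit_disc. norm (z * deriv P z / P z) \<le> 4 * norm z / (1 - (norm z)\<^sup>2))"
proof -
  obtain p q where c: "p \<in> caratheodory" "q \<in> caratheodory"
    and f: "\<And>z. z \<in> unit_disc \<Longrightarrow> f z = z * (p z * q z)"
    using G3_factorization[OF assms] by blast
  have hol: "p holomorphic_on unit_disc" "q holomorphic_on unit_disc" and "p 0 = 1" "q 0 = 1"
    using c by (auto simp: caratheodory_def)
  have "norm (z * deriv (\<lambda>z. p z * q z) z / (p z * q z)) \<le> 4 * norm z / (1 - (norm z)\<^sup>2)"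
    if z: "z \<in> unit_disc" for z
  proof -
    let ?B = "2 / (1 - (norm z)\<^sup>2)"
    have "norm (deriv (\<lambda>z. p z * q z) z / (p z * q z)) \<le> ?B + ?B"
      using c z hol
      by (intro norm_log_deriv_mult_le norm_log_deriv_caratheodory_le) (auto simp: caratheodory_ne_0)
    hence "norm z * norm (deriv (\<lambda>z. p z * q z) z / (p z * q z)) \<le> norm z * (?B + ?B)"
      by (rule mult_left_mono) simp
    thus ?thesis by (simp add: norm_mult norm_divide mult.commute)
  qed
  thus ?thesis using c f hol \<open>p 0 = 1\<close> \<open>q 0 = 1\<close>
    by (intro exI[of _ "\<lambda>z. p z * q z"]) (auto simp: caratheodory_ne_0 intro!: holomorphic_intros)
qed

section \<open>Extremal functions\<close>

definition half_plane_map :: "complex \<Rightarrow> complex"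
  where "half_plane_map z = (1 + z) / (1 - z)"

lemma half_plane_map_caratheodory: "half_plane_map \<in> caratheodory"
proof -
  have ne: "1 - z \<noteq> 0" if "norm z < 1" for z :: complex using that by auto
  have "Re (half_plane_map z) > 0" if "norm z < 1" for z
  proof -
    have "(norm z)\<^sup>2 < 1" using that by (simp add: abs_square_less_1)
    hence 1: "(1 + Re z) * (1 - Re z) - Im z * Im z > 0"
      unfolding cmod_power2 by (simp add: power2_eq_square algebra_simps)
    have "(Re (1 - z))\<^sup>2 + (Im (1 - z))\<^sup>2 > 0"
      using ne[OF that] complex_neq_0[of "1 - z"] by blast
    thus ?thesis using 1 unfolding half_plane_map_def Re_divide
      by (intro divide_pos_pos) auto
  qed
  moreover have "half_plane_map holomorphic_on unit_disc"
    unfolding half_plane_map_def[abs_def] using ne by (intro holomorphic_intros) auto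
  ultimately show ?thesis by (simp add: caratheodory_def half_plane_map_def)
qed

text \<open>
  The point of this function: its logarithmic derivative attains the bound of
  \<open>norm_log_deriv_caratheodory_le\<close> on the whole real diameter, with negative sign of
  \<open>z p'(z) / p(z)\<close> on the negative half.
\<close>

lemma half_plane_map_log_deriv:
  assumes "z \<in> unit_disc"
  shows "z * deriv (\<lambda>z. half_plane_map z ^ n) z / half_plane_map z ^ n = 2 * of_nat n * z / (1 - z\<^sup>2)"
proof -
  have ne: "1 - z \<noteq> 0" "1 + z \<noteq> 0" using assms by (auto simp: add_eq_0_iff)
  have D: "(half_plane_map has_field_derivative 2 / (1 - z)\<^sup>2) (at z)"
    unfolding half_plane_map_def[abs_def] using ne
    by (auto intro!: derivative_eq_intros simp: power2_eq_square field_simps)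
  have "((\<lambda>z. half_plane_map z ^ n) has_field_derivative
      of_nat n * (half_plane_map z ^ (n - 1) * (2 / (1 - z)\<^sup>2))) (at z)"
    using DERIV_power[OF D, of n] by (simp add: mult_ac)
  hence d: "deriv (\<lambda>z. half_plane_map z ^ n) z = of_nat n * (half_plane_map z ^ (n - 1) * (2 / (1 - z)\<^sup>2))"
    by (rule DERIV_imp_deriv)
  have h: "half_plane_map z \<noteq> 0" using ne by (simp add: half_plane_map_def)
  have sq: "1 - z\<^sup>2 = (1 - z) * (1 + z)" by (simp add: power2_eq_square algebra_simps)
  show ?thesis
  proof (cases n)
    case (Suc m)
    have "z * deriv (\<lambda>z. half_plane_map z ^ n) z / half_plane_map z ^ n
        = z * of_nat n * (2 / (1 - z)\<^sup>2) / half_plane_map z"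
      unfolding d using h by (simp add: Suc divide_simps mult_ac del: of_nat_Suc)
    also have "\<dots> = 2 * of_nat n * z / (1 - z\<^sup>2)"
    proof -
      have "(1 - z)\<^sup>2 * half_plane_map z = 1 - z\<^sup>2"
        unfolding sq using ne by (simp add: half_plane_map_def power2_eq_square)
      thus ?thesis by (simp add: mult_ac)
    qed
    finally show ?thesis .
  qed (simp add: d)
qed

lemma half_plane_map_power:
  shows "(\<lambda>z. half_plane_map z ^ n) holomorphic_on unit_disc"
    and "z \<in> unit_disc \<Longrightarrow> half_plane_map z ^ n \<noteq> 0"
    and "(\<lambda>z. z * half_plane_map z ^ n) \<in> normalized"
proof -
  show h: "(\<lambda>z. half_plane_map z ^ n) holomorphic_on unit_disc"
    using half_plane_map_caratheodory by (auto simp: caratheodory_def intro!: holomorphic_intros)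
  show "z \<in> unit_disc \<Longrightarrow> half_plane_map z ^ n \<noteq> 0"
    using caratheodory_ne_0[OF half_plane_map_caratheodory] by simp
  have "((\<lambda>z. z * half_plane_map z ^ n) has_field_derivative 1) (at 0)"
    by (rule derivative_eq_intros holomorphic_derivI[OF h] refl | simp add: half_plane_map_def)+
  thus "(\<lambda>z. z * half_plane_map z ^ n) \<in> normalized"
    using h by (auto simp: normalized_def DERIV_imp_deriv intro!: holomorphic_intros)
qed

text \<open>
  At \<open>z = - R\<close> the extremal function satisfies \<open>z P'(z) / P(z) = - 2 n R / (1 - R\<^sup>2)\<close>, which is
  the critical value \<open>- 1 / k\<^sup>2\<close> by the choice of \<open>R\<close>.
\<close>

lemma admissible_radius_le_if_power_mem:
  assumes R: "0 < R" "R < 1" and eq: "2 * of_nat n * R = 1 / silver_ratio\<^sup>2 * (1 - R\<^sup>2)"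
    and mem: "(\<lambda>z. z * half_plane_map z ^ n) \<in> F" and R': "R' \<in> admissible_radii S_R F"
  shows "R' \<le> R"
proof -
  let ?a = "of_real (- R) :: complex"
  have "1 - R\<^sup>2 > 0" using R by (simp add: abs_square_less_1)
  hence "2 * of_nat n * R / (1 - R\<^sup>2) = 1 / silver_ratio\<^sup>2" unfolding eq by simp
  hence q: "2 * of_nat n * (- R) / (1 - (- R)\<^sup>2) = - (1 / silver_ratio\<^sup>2)" by simp
  have "?a * deriv (\<lambda>z. half_plane_map z ^ n) ?a / half_plane_map ?a ^ n = 2 * of_nat n * ?a / (1 - ?a\<^sup>2)"
    using R by (intro half_plane_map_log_deriv) simp
  also have "\<dots> = of_real (2 * of_nat n * (- R) / (1 - (- R)\<^sup>2))" by simp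
  also have "\<dots> = - of_real (1 / silver_ratio\<^sup>2)" unfolding q by simp
  finally have "R' \<le> norm ?a"
    using half_plane_map_power(1,2) by (intro admissible_radius_le_norm[OF R' mem]) auto
  thus ?thesis using R by simp
qed

lemma remove_sings_quotient_caratheodory:
  assumes h: "h \<in> caratheodory"
    and eq: "\<And>z. z \<in> unit_disc \<Longrightarrow> z \<noteq> 0 \<Longrightarrow> g z \<noteq> 0 \<and> f z = g z * h z"
  shows "remove_sings (\<lambda>z. f z / g z) \<in> caratheodory"
    and "h \<in> caratheodory_half \<Longrightarrow> remove_sings (\<lambda>z. f z / g z) \<in> caratheodory_half"
proof -
  have hol: "h holomorphic_on unit_disc" using h by (simp add: caratheodory_def)
  have q: "remove_sings (\<lambda>z. f z / g z) z = h z" if "z \<in> unit_disc" for z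
    using remove_sings_quotientI[OF hol eq that] by auto
  have "remove_sings (\<lambda>z. f z / g z) holomorphic_on unit_disc"
    using hol by (rule holomorphic_transform) (use q in auto)
  thus c: "remove_sings (\<lambda>z. f z / g z) \<in> caratheodory"
    using h q by (simp add: caratheodory_def)
  thus "h \<in> caratheodory_half \<Longrightarrow> remove_sings (\<lambda>z. f z / g z) \<in> caratheodory_half"
    using q by (simp add: caratheodory_half_def)
qed

lemma extremal_in_G1: "(\<lambda>z. z * half_plane_map z ^ 3) \<in> G1"
  unfolding G1_def
  by (intro CollectI conjI bexI[of _ "\<lambda>z. z * half_plane_map z ^ 2"] bexI[of _ half_plane_map]
      remove_sings_quotient_caratheodory(1)[OF half_plane_map_caratheodory]
      half_plane_map_power half_plane_map_caratheodory)
    (use caratheodory_ne_0[OF half_plane_map_caratheodory] in \<open>auto simp: power2_eq_square power3_eq_cube\<close>)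

lemma extremal_in_G3: "(\<lambda>z. z * half_plane_map z ^ 2) \<in> G3"
  unfolding G3_def
  by (intro CollectI conjI bexI[of _ half_plane_map]
      remove_sings_quotient_caratheodory(1)[OF half_plane_map_caratheodory]
      half_plane_map_power half_plane_map_caratheodory)
    (use caratheodory_ne_0[OF half_plane_map_caratheodory] in \<open>auto simp: power2_eq_square\<close>)

lemma one_in_caratheodory_half: "(\<lambda>z. 1) \<in> caratheodory_half"
  by (auto simp: caratheodory_half_def caratheodory_def)

text \<open>
  Take \<open>g z = z * p z\<close>, for which \<open>g / (z p)\<close> is the constant \<open>1\<close>. This bounds the radius of
  \<open>G2\<close> away from \<open>1\<close>.
\<close>

lemma G3_subset_G2: "G3 \<subseteq> G2"
proof
  fix f assume "f \<in> G3"
  then obtain p where f: "f \<in> normalized" and p: "p \<in> caratheodory"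
    "remove_sings (\<lambda>z. f z / (z * p z)) \<in> caratheodory"
    by (auto simp: G3_def)
  have "remove_sings (\<lambda>z. (z * p z) / (z * p z)) \<in> caratheodory_half"
    using one_in_caratheodory_half caratheodory_ne_0[OF p(1)]
    by (intro remove_sings_quotient_caratheodory(2)[of "\<lambda>z. 1"]) (auto simp: caratheodory_half_def)
  thus "f \<in> G2"
    using f p mult_caratheodory_normalized[OF p(1)] unfolding G2_def
    by (intro CollectI conjI bexI[of _ "\<lambda>z. z * p z"] bexI[of _ p])
qed

section \<open>The radii\<close>

text \<open>
  The positive root of \<open>b x\<^sup>2 + 2 a x = c\<close>, written with the square root in the denominator as in
  the claimed radii.
\<close>

lemma positive_root:
  fixes a b c :: real
  assumes "a > 0" "b > 0" "c > 0"
  shows "c / (a + sqrt (a\<^sup>2 + b * c)) > 0"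
    "2 * a * (c / (a + sqrt (a\<^sup>2 + b * c))) + b * (c / (a + sqrt (a\<^sup>2 + b * c)))\<^sup>2 = c"
proof -
  define s where "s = sqrt (a\<^sup>2 + b * c)"
  have s: "s > 0" "s\<^sup>2 = a\<^sup>2 + b * c" using assms by (auto simp: s_def add_pos_pos)
  show "c / (a + sqrt (a\<^sup>2 + b * c)) > 0" using assms s(1) by (simp add: s_def[symmetric] add_pos_pos)
  have "2 * a * (c / (a + s)) + b * (c / (a + s))\<^sup>2 = c * (2 * a * (a + s) + b * c) / (a + s)\<^sup>2"
    using assms s(1) by (simp add: divide_simps power2_eq_square) (simp add: algebra_simps)
  also have "2 * a * (a + s) + b * c = (a + s)\<^sup>2"
    using s(2) by (simp add: power2_eq_square algebra_simps)
  finally show "2 * a * (c / (a + sqrt (a\<^sup>2 + b * c))) + b * (c / (a + sqrt (a\<^sup>2 + b * c)))\<^sup>2 = c"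
    using assms s(1) unfolding s_def[symmetric] by simp
qed

lemma positive_root_lt_1:
  fixes a b c R :: real
  assumes "a > 1" "b > 0" "c < 1" "R > 0" "a * R + b * R\<^sup>2 = c"
  shows "R < 1"
proof -
  have "R < a * R" using assms by simp
  moreover have "b * R\<^sup>2 > 0" using assms by simp
  ultimately show ?thesis using assms by linarith
qed

lemma sqrt2_bounds: "1.41421356 < sqrt 2" "sqrt 2 < 1.41421357"
  by (rule real_less_rsqrt, simp add: power2_eq_square)
     (rule real_less_lsqrt, auto simp: power2_eq_square)

lemma abs_quotient_minus_lt:
  fixes a b q e :: real
  assumes "b > 0" "(q - e) * b < a" "a < (q + e) * b"
  shows "\<bar>a / b - q\<bar> < e"
proof -
  have "q - e < a / b" "a / b < q + e"
    using assms by (auto simp: pos_less_divide_eq pos_divide_less_eq)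
  thus ?thesis by linarith
qed

lemma radii_approximations:
  "\<bar>(3 - 2 * sqrt 2) / (3 + sqrt (26 - 12 * sqrt 2)) - 0.0285\<bar> < 0.0001"
  "\<bar>(20 - 14 * sqrt 2) / ((2 - sqrt 2) * (5 + sqrt (105 - 56 * sqrt 2))) - 0.0340\<bar> < 0.0001"
  "\<bar>(3 - 2 * sqrt 2) / (2 + sqrt (21 - 12 * sqrt 2)) - 0.0428\<bar> < 0.0001"
proof -
  note b = sqrt2_bounds
  have 1: "3.004 < sqrt (26 - 12 * sqrt 2)" "sqrt (26 - 12 * sqrt 2) < 3.006"
    and 2: "5.079 < sqrt (105 - 56 * sqrt 2)" "sqrt (105 - 56 * sqrt 2) < 5.081"
    and 3: "2.007 < sqrt (21 - 12 * sqrt 2)" "sqrt (21 - 12 * sqrt 2) < 2.008"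
    by (rule real_less_rsqrt real_less_lsqrt; use b in \<open>simp add: power2_eq_square\<close>)+
  show "\<bar>(3 - 2 * sqrt 2) / (3 + sqrt (26 - 12 * sqrt 2)) - 0.0285\<bar> < 0.0001"
    using 1 b by (intro abs_quotient_minus_lt) auto
  show "\<bar>(3 - 2 * sqrt 2) / (2 + sqrt (21 - 12 * sqrt 2)) - 0.0428\<bar> < 0.0001"
    using 3 b by (intro abs_quotient_minus_lt) auto
  have "(20 - 14 * sqrt 2) / ((2 - sqrt 2) * (5 + sqrt (105 - 56 * sqrt 2)))
     = 2 * (3 - 2 * sqrt 2) / (5 + sqrt (105 - 56 * sqrt 2))"
  proof -
    have "20 - 14 * sqrt 2 = (2 - sqrt 2) * (2 * (3 - 2 * sqrt 2))" by (simp add: algebra_simps)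
    moreover have "2 - sqrt 2 \<noteq> 0" using b by auto
    ultimately show ?thesis by simp
  qed
  also have "\<bar>\<dots> - 0.0340\<bar> < 0.0001"
    using 2 b by (intro abs_quotient_minus_lt) auto
  finally show "\<bar>(20 - 14 * sqrt 2) / ((2 - sqrt 2) * (5 + sqrt (105 - 56 * sqrt 2))) - 0.0340\<bar> < 0.0001" .
qed

theorem theorem3p8:
  shows
    "is_class_radius S_R G1 ((3 - 2 * sqrt 2) / (3 + sqrt (26 - 12 * sqrt 2))) \<and>
     \<bar>(3 - 2 * sqrt 2) / (3 + sqrt (26 - 12 * sqrt 2)) - 0.0285\<bar> < 0.0001 \<and>
     (\<exists>R. is_class_radius S_R G2 R \<and>
        R \<ge> (20 - 14 * sqrt 2) / ((2 - sqrt 2) * (5 + sqrt (105 - 56 * sqrt 2)))) \<and>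
     \<bar>(20 - 14 * sqrt 2) / ((2 - sqrt 2) * (5 + sqrt (105 - 56 * sqrt 2))) - 0.0340\<bar> < 0.0001 \<and>
     is_class_radius S_R G3 ((3 - 2 * sqrt 2) / (2 + sqrt (21 - 12 * sqrt 2))) \<and>
     \<bar>(3 - 2 * sqrt 2) / (2 + sqrt (21 - 12 * sqrt 2)) - 0.0428\<bar> < 0.0001"
proof -
  define c where "c = 3 - 2 * sqrt 2"
  have c: "0 < c" "c < 1" using sqrt2_bounds by (auto simp: c_def)
  have c_eq: "1 / silver_ratio\<^sup>2 = c" by (simp add: c_def inverse_silver_ratio_square)

  define R1 where "R1 = (3 - 2 * sqrt 2) / (3 + sqrt (26 - 12 * sqrt 2))"
  have "R1 = c / (3 + sqrt (3\<^sup>2 + c * c))" by (simp add: R1_def c_def algebra_simps)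
  (* the equation 6 r / (1 - r^2) = c, cleared of its denominator *)
  hence R1: "0 < R1" "6 * R1 + c * R1\<^sup>2 = c" using positive_root[of 3 c c] c by auto
  have R1_lt: "R1 < 1" using positive_root_lt_1[OF _ c(1,2) R1] by simp
  have G1: "is_class_radius S_R G1 R1"
    unfolding is_class_radius_def
  proof (intro conjI ballI)
    show "R1 \<in> admissible_radii S_R G1"
      by (rule admissible_radius_if_log_deriv_bound[where \<alpha> = 6 and \<beta> = 0])
        (use G1_log_deriv_bound R1 R1_lt c_eq in \<open>auto simp: algebra_simps\<close>)
    show "R' \<le> R1" if "R' \<in> admissible_radii S_R G1" for R'
      using admissible_radius_le_if_power_mem[OF R1(1) R1_lt _ extremal_in_G1 that] R1(2) c_eq
      by (auto simp: algebra_simps)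
  qed

  define R3 where "R3 = (3 - 2 * sqrt 2) / (2 + sqrt (21 - 12 * sqrt 2))"
  have "R3 = c / (2 + sqrt (2\<^sup>2 + c * c))" by (simp add: R3_def c_def algebra_simps)
  (* the equation 4 r / (1 - r^2) = c, cleared of its denominator *)
  hence R3: "0 < R3" "4 * R3 + c * R3\<^sup>2 = c" using positive_root[of 2 c c] c by auto
  have R3_lt: "R3 < 1" using positive_root_lt_1[OF _ c(1,2) R3] by simp
  (* stated for an arbitrary class, because it bounds the radius of G2 as well *)
  have le_R3: "R' \<le> R3"
    if "R' \<in> admissible_radii S_R F" "(\<lambda>z. z * half_plane_map z ^ 2) \<in> F" for R' F
    using admissible_radius_le_if_power_mem[OF R3(1) R3_lt _ that(2,1)] R3(2) c_eq
    by (auto simp: algebra_simps)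
  have G3: "is_class_radius S_R G3 R3"
    unfolding is_class_radius_def
  proof (intro conjI ballI)
    show "R3 \<in> admissible_radii S_R G3"
      by (rule admissible_radius_if_log_deriv_bound[where \<alpha> = 4 and \<beta> = 0])
        (use G3_log_deriv_bound R3 R3_lt c_eq in \<open>auto simp: algebra_simps\<close>)
    show "R' \<le> R3" if "R' \<in> admissible_radii S_R G3" for R'
      using le_R3[OF that extremal_in_G3] .
  qed

  define R2 where "R2 = (20 - 14 * sqrt 2) / ((2 - sqrt 2) * (5 + sqrt (105 - 56 * sqrt 2)))"
  have "R2 = c / (5 / 2 + sqrt ((5 / 2)\<^sup>2 + (1 + c) * c))"
  proof -
    have sqr: "(5 / 2)\<^sup>2 + (1 + c) * c = (105 - 56 * sqrt 2) / 4"
      by (simp add: c_def power2_eq_square algebra_simps)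
    have den: "5 / 2 + sqrt ((5 / 2)\<^sup>2 + (1 + c) * c) = (5 + sqrt (105 - 56 * sqrt 2)) / 2"
      unfolding sqr by (simp add: real_sqrt_divide)
    have num: "20 - 14 * sqrt 2 = (2 - sqrt 2) * (2 * c)" by (simp add: c_def algebra_simps)
    have "2 - sqrt 2 \<noteq> 0" using sqrt2_bounds by auto
    thus ?thesis unfolding R2_def den num by simp
  qed
  (* the equation (5 r + r^2) / (1 - r^2) = c, cleared of its denominator *)
  hence R2: "0 < R2" "5 * R2 + (1 + c) * R2\<^sup>2 = c" using positive_root[of "5 / 2" "1 + c" c] c by auto
  have R2_lt: "R2 < 1" using positive_root_lt_1[OF _ _ c(2) R2] c by simp
  have "R2 \<in> admissible_radii S_R G2"
    by (rule admissible_radius_if_log_deriv_bound[where \<alpha> = 5 and \<beta> = 1])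
      (use G2_log_deriv_bound R2 R2_lt c_eq in \<open>auto simp: algebra_simps\<close>)
  hence G2: "\<exists>R. is_class_radius S_R G2 R \<and> R \<ge> R2"
    using is_class_radius_Sup[OF _ R3_lt, of R2 S_R G2] le_R3 extremal_in_G3 G3_subset_G2 by blast
  show ?thesis
    using G1 G2 G3 radii_approximations unfolding R1_def R2_def R3_def by blast
qed

end
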